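(* For any two bounded operators $W_1,W_2$ on $\mathcal H$, $\big|\,\|W_2\|_\mu-\|W_1\|_\mu\,\big|\le\|W_2-W_1\|$, where $\|\cdot\|$ is the operator norm. Consequently $W\mapsto\|W\|_\mu$ is a continuous function on the space of bounded operators on $\mathcal H$ with the operator-norm topology.
   Context: $(\mathcal X,\mathcal B,\mu)$ is a probability measure space and $\mathcal H=L^2(\mathcal X,\mu)$ (complex-valued). For $X\in\mathcal B$, $\pi_X:\mathcal H\to\mathcal H$ is the orthogonal projector $\pi_Xf=\mathbf 1_X f$. A partition is a finite family $\chi=\{Y_1,\dots,Y_J\}\subset\mathcal B$ with $\mu(\mathcal X\setminus\bigcup_j Y_j)=0$ and $\mu(Y_j\cap Y_k)=0$ for $j\ne k$. For a bounded operator $W$ on $\mathcal H$ with operator norm $\|W\|$, put $\mathcal M_\chi(W)=\sum_{j=1}^J\mu(Y_j)\|W\pi_{Y_j}\|^2$, and define the $\mu$-norm $\|W\|_\mu=\inf_\chi\sqrt{\mathcal M_\chi(W)}$, the infimum being over all partitions $\chi$. *)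

theory Defs
  imports "HOL-Probability.Probability"
begin

section \<open>The space of square-integrable functions modulo null sets\<close>

text \<open>
  The type of a HOL term cannot depend on the measure \<open>M\<close>, so \<open>L\<^sup>2(M)\<close> is an explicit carrier set:
  its elements are the classes of complex square-integrable functions under almost-everywhere
  equality. Values outside \<open>space M\<close> are irrelevant, since almost-everywhere equality ignores them.
\<close>

definition sq_int :: "'a measure \<Rightarrow> ('a \<Rightarrow> complex) set" where
  "sq_int M = {f \<in> borel_measurable M. integrable M (\<lambda>x. (cmod (f x))\<^sup>2)}"

definition ae_rel :: "'a measure \<Rightarrow> (('a \<Rightarrow> complex) \<times> ('a \<Rightarrow> complex)) set" where
  "ae_rel M = {(f, g). f \<in> sq_int M \<and> g \<in> sq_int M \<and> (AE x in M. f x = g x)}"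

definition L2 :: "'a measure \<Rightarrow> ('a \<Rightarrow> complex) set set" where
  "L2 M = sq_int M // ae_rel M"

definition L2_class :: "'a measure \<Rightarrow> ('a \<Rightarrow> complex) \<Rightarrow> ('a \<Rightarrow> complex) set" where
  "L2_class M f = ae_rel M `` {f}"

text \<open>All the operations below are independent of the representative that is chosen here.\<close>

definition L2_rep :: "('a \<Rightarrow> complex) set \<Rightarrow> 'a \<Rightarrow> complex" where
  "L2_rep F = (SOME f. f \<in> F)"

definition L2_add ::
    "'a measure \<Rightarrow> ('a \<Rightarrow> complex) set \<Rightarrow> ('a \<Rightarrow> complex) set \<Rightarrow> ('a \<Rightarrow> complex) set" where
  "L2_add M F G = L2_class M (\<lambda>x. L2_rep F x + L2_rep G x)"

definition L2_scale ::
    "'a measure \<Rightarrow> complex \<Rightarrow> ('a \<Rightarrow> complex) set \<Rightarrow> ('a \<Rightarrow> complex) set" where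
  "L2_scale M c F = L2_class M (\<lambda>x. c * L2_rep F x)"

definition L2_diff ::
    "'a measure \<Rightarrow> ('a \<Rightarrow> complex) set \<Rightarrow> ('a \<Rightarrow> complex) set \<Rightarrow> ('a \<Rightarrow> complex) set" where
  "L2_diff M F G = L2_class M (\<lambda>x. L2_rep F x - L2_rep G x)"

definition L2_norm :: "'a measure \<Rightarrow> ('a \<Rightarrow> complex) set \<Rightarrow> real" where
  "L2_norm M F = sqrt (\<integral>x. (cmod (L2_rep F x))\<^sup>2 \<partial>M)"


section \<open>Bounded operators\<close>

type_synonym 'a L2_op = "('a \<Rightarrow> complex) set \<Rightarrow> ('a \<Rightarrow> complex) set"

text \<open>
  Operators are \<^const>\<open>extensional\<close> functions, so that two operators agreeing on \<^term>\<open>L2 M\<close>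
  are equal as HOL functions.
\<close>

definition bounded_ops :: "'a measure \<Rightarrow> 'a L2_op set" where
  "bounded_ops M = {W \<in> L2 M \<rightarrow>\<^sub>E L2 M.
     (\<forall>F\<in>L2 M. \<forall>G\<in>L2 M. W (L2_add M F G) = L2_add M (W F) (W G)) \<and>
     (\<forall>c. \<forall>F\<in>L2 M. W (L2_scale M c F) = L2_scale M c (W F)) \<and>
     (\<exists>C. \<forall>F\<in>L2 M. L2_norm M (W F) \<le> C * L2_norm M F)}"

definition op_diff :: "'a measure \<Rightarrow> 'a L2_op \<Rightarrow> 'a L2_op \<Rightarrow> 'a L2_op" where
  "op_diff M V W = (\<lambda>F\<in>L2 M. L2_diff M (V F) (W F))"

definition op_norm :: "'a measure \<Rightarrow> 'a L2_op \<Rightarrow> real" where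
  "op_norm M W = (SUP F\<in>{F \<in> L2 M. L2_norm M F \<le> 1}. L2_norm M (W F))"

text \<open>
  The locale \<^locale>\<open>Metric_space\<close> wants a symmetric and nonnegative function on the whole type, hence
  the value \<open>0\<close> off the carrier.
\<close>

definition op_dist :: "'a measure \<Rightarrow> 'a L2_op \<Rightarrow> 'a L2_op \<Rightarrow> real" where
  "op_dist M V W =
     (if V \<in> bounded_ops M \<and> W \<in> bounded_ops M then op_norm M (op_diff M V W) else 0)"

definition op_proj :: "'a measure \<Rightarrow> 'a set \<Rightarrow> 'a L2_op" where
  "op_proj M Y = (\<lambda>F\<in>L2 M. L2_class M (\<lambda>x. indicator Y x * L2_rep F x))"


section \<open>The \<open>\<mu>\<close>-norm\<close>

definition is_partition :: "'a measure \<Rightarrow> nat \<Rightarrow> (nat \<Rightarrow> 'a set) \<Rightarrow> bool" where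
  "is_partition M J Y \<longleftrightarrow>
     (\<forall>j\<in>{1..J}. Y j \<in> sets M) \<and>
     measure M (space M - (\<Union>j\<in>{1..J}. Y j)) = 0 \<and>
     (\<forall>j\<in>{1..J}. \<forall>k\<in>{1..J}. j \<noteq> k \<longrightarrow> measure M (Y j \<inter> Y k) = 0)"

definition partition_sum :: "'a measure \<Rightarrow> nat \<Rightarrow> (nat \<Rightarrow> 'a set) \<Rightarrow> 'a L2_op \<Rightarrow> real" where
  "partition_sum M J Y W =
     (\<Sum>j=1..J. measure M (Y j) * (op_norm M (compose (L2 M) W (op_proj M (Y j))))\<^sup>2)"

definition mu_norm :: "'a measure \<Rightarrow> 'a L2_op \<Rightarrow> real" where
  "mu_norm M W = Inf {sqrt (partition_sum M J Y W) | J Y. is_partition M J Y}"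


section \<open>The bounded operators form a metric space\<close>

lemma sq_int_add:
  assumes f: "f \<in> sq_int M" and g: "g \<in> sq_int M"
  shows "(\<lambda>x. f x + g x) \<in> sq_int M"
proof -
  have [measurable]: "f \<in> borel_measurable M" "g \<in> borel_measurable M"
    using f g by (auto simp: sq_int_def)
  have "integrable M (\<lambda>x. 2 * (cmod (f x))\<^sup>2 + 2 * (cmod (g x))\<^sup>2)"
    using f g by (auto simp: sq_int_def)
  then have "integrable M (\<lambda>x. (cmod (f x + g x))\<^sup>2)"
  proof (rule Bochner_Integration.integrable_bound)
    show "AE x in M. norm ((cmod (f x + g x))\<^sup>2) \<le> norm (2 * (cmod (f x))\<^sup>2 + 2 * (cmod (g x))\<^sup>2)"
    proof (rule AE_I2)
      fix x
      have "(cmod (f x + g x))\<^sup>2 \<le> (cmod (f x) + cmod (g x))\<^sup>2"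
        by (simp add: norm_triangle_ineq power_mono)
      also have "\<dots> \<le> 2 * (cmod (f x))\<^sup>2 + 2 * (cmod (g x))\<^sup>2"
        using sum_squares_bound[of "cmod (f x)" "cmod (g x)"] by (simp add: power2_sum)
      finally show "norm ((cmod (f x + g x))\<^sup>2) \<le> norm (2 * (cmod (f x))\<^sup>2 + 2 * (cmod (g x))\<^sup>2)"
        by simp
    qed
  qed measurable
  then show ?thesis by (simp add: sq_int_def)
qed

lemma sq_int_scale: "f \<in> sq_int M \<Longrightarrow> (\<lambda>x. c * f x) \<in> sq_int M"
  by (auto simp: sq_int_def norm_mult power_mult_distrib)

lemma sq_int_diff:
  assumes f: "f \<in> sq_int M" and g: "g \<in> sq_int M"
  shows "(\<lambda>x. f x - g x) \<in> sq_int M"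
  using sq_int_add[OF f sq_int_scale[OF g, of "-1"]] by simp

lemma equiv_ae_rel: "equiv (sq_int M) (ae_rel M)"
  unfolding equiv_def refl_on_def sym_def trans_def ae_rel_def by (auto elim: AE_mp)

lemma L2_class_in: "f \<in> sq_int M \<Longrightarrow> L2_class M f \<in> L2 M"
  unfolding L2_def L2_class_def by (rule quotientI)

lemma L2_class_eq:
  "f \<in> sq_int M \<Longrightarrow> g \<in> sq_int M \<Longrightarrow> (AE x in M. f x = g x) \<Longrightarrow> L2_class M f = L2_class M g"
  unfolding L2_class_def by (rule equiv_class_eq[OF equiv_ae_rel]) (simp add: ae_rel_def)

lemma L2_rep_class:
  assumes "f \<in> sq_int M"
  shows "L2_rep (L2_class M f) \<in> sq_int M" "AE x in M. L2_rep (L2_class M f) x = f x"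
proof -
  have "f \<in> L2_class M f"
    using assms by (simp add: L2_class_def ae_rel_def)
  then have "L2_rep (L2_class M f) \<in> L2_class M f"
    unfolding L2_rep_def by (rule someI[where P="\<lambda>f. f \<in> _"])
  then show "L2_rep (L2_class M f) \<in> sq_int M" "AE x in M. L2_rep (L2_class M f) x = f x"
    by (auto simp: L2_class_def ae_rel_def elim: AE_mp)
qed

lemma L2_E:
  assumes "F \<in> L2 M"
  obtains f where "f \<in> sq_int M" "F = L2_class M f"
  using assms unfolding L2_def L2_class_def by (auto elim: quotientE)

lemma L2_rep_sq_int: "F \<in> L2 M \<Longrightarrow> L2_rep F \<in> sq_int M"
  by (metis L2_E L2_rep_class(1))

lemma L2_class_rep: "F \<in> L2 M \<Longrightarrow> L2_class M (L2_rep F) = F"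
  by (metis L2_E L2_rep_class L2_class_eq)

lemma L2_norm_class:
  assumes f: "f \<in> sq_int M"
  shows "L2_norm M (L2_class M f) = sqrt (\<integral>x. (cmod (f x))\<^sup>2 \<partial>M)"
proof -
  have [measurable]: "f \<in> borel_measurable M" "L2_rep (L2_class M f) \<in> borel_measurable M"
    using f L2_rep_class(1)[OF f] by (auto simp: sq_int_def)
  show ?thesis
    unfolding L2_norm_def using L2_rep_class(2)[OF f]
    by (intro arg_cong[where f=sqrt] integral_cong_AE) (auto elim: AE_mp)
qed

lemma L2_diff_class:
  assumes "f \<in> sq_int M" "g \<in> sq_int M"
  shows "L2_diff M (L2_class M f) (L2_class M g) = L2_class M (\<lambda>x. f x - g x)"
  unfolding L2_diff_def
  using assms L2_rep_class[OF assms(1)] L2_rep_class[OF assms(2)]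
  by (intro L2_class_eq sq_int_diff) auto

lemma L2_add_class:
  assumes "f \<in> sq_int M" "g \<in> sq_int M"
  shows "L2_add M (L2_class M f) (L2_class M g) = L2_class M (\<lambda>x. f x + g x)"
  unfolding L2_add_def
  using assms L2_rep_class[OF assms(1)] L2_rep_class[OF assms(2)]
  by (intro L2_class_eq sq_int_add) auto

lemma L2_scale_class:
  assumes "f \<in> sq_int M"
  shows "L2_scale M c (L2_class M f) = L2_class M (\<lambda>x. c * f x)"
  unfolding L2_scale_def
  using assms L2_rep_class[OF assms(1)]
  by (intro L2_class_eq sq_int_scale) auto

lemma L2_add_in: "F \<in> L2 M \<Longrightarrow> G \<in> L2 M \<Longrightarrow> L2_add M F G \<in> L2 M"
  unfolding L2_add_def by (intro L2_class_in sq_int_add L2_rep_sq_int)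

lemma L2_diff_in: "F \<in> L2 M \<Longrightarrow> G \<in> L2 M \<Longrightarrow> L2_diff M F G \<in> L2 M"
  unfolding L2_diff_def by (intro L2_class_in sq_int_diff L2_rep_sq_int)

lemma L2_scale_in: "F \<in> L2 M \<Longrightarrow> L2_scale M c F \<in> L2 M"
  unfolding L2_scale_def by (intro L2_class_in sq_int_scale L2_rep_sq_int)

lemma zero_sq_int: "(\<lambda>x. 0) \<in> sq_int M"
  by (simp add: sq_int_def)

lemma L2_norm_nonneg: "0 \<le> L2_norm M F"
  by (simp add: L2_norm_def)

lemma L2_norm_zero: "L2_norm M (L2_class M (\<lambda>x. 0)) = 0"
  by (simp add: L2_norm_class[OF zero_sq_int])

lemma sq_int_null_iff:
  assumes f: "f \<in> sq_int M"
  shows "(\<integral>x. (cmod (f x))\<^sup>2 \<partial>M) = 0 \<longleftrightarrow> (AE x in M. f x = 0)"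
  using f by (subst integral_nonneg_eq_0_iff_AE) (auto simp: sq_int_def)

lemma L2_norm_scale:
  assumes F: "F \<in> L2 M"
  shows "L2_norm M (L2_scale M c F) = cmod c * L2_norm M F"
proof -
  obtain f where f: "f \<in> sq_int M" "F = L2_class M f" by (rule L2_E[OF F])
  show ?thesis
    by (simp add: f L2_scale_class L2_norm_class sq_int_scale norm_mult power_mult_distrib
        real_sqrt_mult)
qed

lemma L2_norm_add:
  assumes F: "F \<in> L2 M" and G: "G \<in> L2 M"
  shows "L2_norm M (L2_add M F G) \<le> L2_norm M F + L2_norm M G"
proof -
  obtain f where f: "f \<in> sq_int M" "F = L2_class M f" by (rule L2_E[OF F])
  obtain g where g: "g \<in> sq_int M" "G = L2_class M g" by (rule L2_E[OF G])
  define h where "h = (\<lambda>x. f x + g x)"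
  have h: "h \<in> sq_int M" unfolding h_def by (intro sq_int_add f g)
  have [measurable]: "f \<in> borel_measurable M" "g \<in> borel_measurable M" "h \<in> borel_measurable M"
    using f g h by (auto simp: sq_int_def)
  have fi: "integrable M (\<lambda>x. (cmod (f x))\<^sup>2)" and gi: "integrable M (\<lambda>x. (cmod (g x))\<^sup>2)"
    and hi: "integrable M (\<lambda>x. (cmod (h x))\<^sup>2)"
    using f g h by (auto simp: sq_int_def)
  let ?a = "sqrt (\<integral>x. (cmod (f x))\<^sup>2 \<partial>M)" and ?b = "sqrt (\<integral>x. (cmod (g x))\<^sup>2 \<partial>M)"
  have a2: "?a\<^sup>2 = (\<integral>x. (cmod (f x))\<^sup>2 \<partial>M)" and b2: "?b\<^sup>2 = (\<integral>x. (cmod (g x))\<^sup>2 \<partial>M)"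
    by simp_all
  have "sqrt (\<integral>x. (cmod (h x))\<^sup>2 \<partial>M) \<le> ?a + ?b"
  proof (cases "?a = 0 \<or> ?b = 0")
    case True
    then show ?thesis
    proof
      assume a0: "?a = 0"
      then have "AE x in M. f x = 0" using sq_int_null_iff[OF f(1)] by simp
      then have "(\<integral>x. (cmod (h x))\<^sup>2 \<partial>M) = (\<integral>x. (cmod (g x))\<^sup>2 \<partial>M)"
        by (intro integral_cong_AE) (auto simp: h_def)
      then show ?thesis using a0 by simp
    next
      assume b0: "?b = 0"
      then have "AE x in M. g x = 0" using sq_int_null_iff[OF g(1)] by simp
      then have "(\<integral>x. (cmod (h x))\<^sup>2 \<partial>M) = (\<integral>x. (cmod (f x))\<^sup>2 \<partial>M)"
        by (intro integral_cong_AE) (auto simp: h_def)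
      then show ?thesis using b0 by simp
    qed
  next
    case False
    define a where "a = ?a"
    define b where "b = ?b"
    have "0 \<le> ?a" "0 \<le> ?b" by simp_all
    with False have ab: "a > 0" "b > 0" unfolding a_def b_def by linarith+
    have pw: "(cmod (h x))\<^sup>2 \<le> (1 + b / a) * (cmod (f x))\<^sup>2 + (1 + a / b) * (cmod (g x))\<^sup>2" for x
    proof -
      have "0 \<le> (b * cmod (f x) - a * cmod (g x))\<^sup>2 / (a * b)" using ab by simp
      also have "\<dots> = b / a * (cmod (f x))\<^sup>2 + a / b * (cmod (g x))\<^sup>2
                        - 2 * cmod (f x) * cmod (g x)"
        using ab by (simp add: field_simps power2_eq_square)
      finally have "2 * cmod (f x) * cmod (g x) \<le> b / a * (cmod (f x))\<^sup>2 + a / b * (cmod (g x))\<^sup>2"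
        by simp
      moreover have "(cmod (h x))\<^sup>2 \<le> (cmod (f x) + cmod (g x))\<^sup>2"
        by (simp add: h_def norm_triangle_ineq power_mono)
      ultimately show ?thesis by (simp add: power2_sum algebra_simps)
    qed
    have "(\<integral>x. (cmod (h x))\<^sup>2 \<partial>M)
        \<le> (\<integral>x. (1 + b / a) * (cmod (f x))\<^sup>2 + (1 + a / b) * (cmod (g x))\<^sup>2 \<partial>M)"
      using fi gi hi by (intro integral_mono pw) auto
    also have "\<dots> = (1 + b / a) * a\<^sup>2 + (1 + a / b) * b\<^sup>2"
      using fi gi by (simp add: a_def b_def)
    also have "\<dots> = (a + b)\<^sup>2"
      using ab by (simp add: field_simps power2_eq_square)
    finally have "sqrt (\<integral>x. (cmod (h x))\<^sup>2 \<partial>M) \<le> a + b"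
      using ab by (intro real_le_lsqrt) auto
    then show ?thesis by (simp add: a_def b_def)
  qed
  then show ?thesis
    using h by (simp add: f g L2_add_class L2_norm_class h_def)
qed

lemma L2_norm_diff_0:
  assumes F: "F \<in> L2 M" and G: "G \<in> L2 M" and "L2_norm M (L2_diff M F G) = 0"
  shows "F = G"
proof -
  obtain f where f: "f \<in> sq_int M" "F = L2_class M f" by (rule L2_E[OF F])
  obtain g where g: "g \<in> sq_int M" "G = L2_class M g" by (rule L2_E[OF G])
  have "AE x in M. f x - g x = 0"
    using assms(3) sq_int_null_iff[OF sq_int_diff[OF f(1) g(1)]]
    by (simp add: f g L2_diff_class L2_norm_class sq_int_diff)
  then show ?thesis unfolding f g using f g by (intro L2_class_eq) auto
qed

lemma L2_diff_commute:
  assumes F: "F \<in> L2 M" and G: "G \<in> L2 M"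
  shows "L2_norm M (L2_diff M F G) = L2_norm M (L2_diff M G F)"
proof -
  obtain f where f: "f \<in> sq_int M" "F = L2_class M f" by (rule L2_E[OF F])
  obtain g where g: "g \<in> sq_int M" "G = L2_class M g" by (rule L2_E[OF G])
  show ?thesis
    by (simp add: f g L2_diff_class L2_norm_class sq_int_diff norm_minus_commute)
qed

lemma L2_norm_diff_triangle:
  assumes F: "F \<in> L2 M" and G: "G \<in> L2 M" and H: "H \<in> L2 M"
  shows "L2_norm M (L2_diff M F H) \<le> L2_norm M (L2_diff M F G) + L2_norm M (L2_diff M G H)"
proof -
  obtain f where f: "f \<in> sq_int M" "F = L2_class M f" by (rule L2_E[OF F])
  obtain g where g: "g \<in> sq_int M" "G = L2_class M g" by (rule L2_E[OF G])
  obtain h where h: "h \<in> sq_int M" "H = L2_class M h" by (rule L2_E[OF H])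
  have "L2_diff M F H = L2_add M (L2_diff M F G) (L2_diff M G H)"
    by (simp add: f g h L2_diff_class L2_add_class sq_int_diff)
  then show ?thesis using L2_norm_add[OF L2_diff_in[OF F G] L2_diff_in[OF G H]] by simp
qed

lemma L2_norm_diff_le:
  assumes F: "F \<in> L2 M" and G: "G \<in> L2 M"
  shows "L2_norm M (L2_diff M F G) \<le> L2_norm M F + L2_norm M G"
proof -
  obtain f where f: "f \<in> sq_int M" "F = L2_class M f" by (rule L2_E[OF F])
  obtain g where g: "g \<in> sq_int M" "G = L2_class M g" by (rule L2_E[OF G])
  have "L2_diff M F G = L2_add M F (L2_scale M (-1) G)"
    using sq_int_scale[OF g(1), of "-1"]
    by (simp add: f g L2_diff_class L2_add_class L2_scale_class sq_int_scale)
  then show ?thesis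
    using L2_norm_add[OF F L2_scale_in[OF G, of "-1"]] L2_norm_scale[OF G, of "-1"] by simp
qed

lemma L2_diff_scale:
  assumes F: "F \<in> L2 M" and G: "G \<in> L2 M"
  shows "L2_diff M (L2_scale M c F) (L2_scale M c G) = L2_scale M c (L2_diff M F G)"
proof -
  obtain f where f: "f \<in> sq_int M" "F = L2_class M f" by (rule L2_E[OF F])
  obtain g where g: "g \<in> sq_int M" "G = L2_class M g" by (rule L2_E[OF G])
  show ?thesis
    by (simp add: f g L2_diff_class L2_scale_class sq_int_diff sq_int_scale algebra_simps)
qed

lemma L2_diff_add:
  assumes F: "F \<in> L2 M" and G: "G \<in> L2 M" and F': "F' \<in> L2 M" and G': "G' \<in> L2 M"
  shows "L2_diff M (L2_add M F G) (L2_add M F' G') = L2_add M (L2_diff M F F') (L2_diff M G G')"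
proof -
  obtain f where f: "f \<in> sq_int M" "F = L2_class M f" by (rule L2_E[OF F])
  obtain g where g: "g \<in> sq_int M" "G = L2_class M g" by (rule L2_E[OF G])
  obtain f' where f': "f' \<in> sq_int M" "F' = L2_class M f'" by (rule L2_E[OF F'])
  obtain g' where g': "g' \<in> sq_int M" "G' = L2_class M g'" by (rule L2_E[OF G'])
  show ?thesis
    by (simp add: f g f' g' L2_diff_class L2_add_class sq_int_diff sq_int_add algebra_simps)
qed

lemma bounded_opsD:
  assumes "W \<in> bounded_ops M" "F \<in> L2 M"
  shows "W F \<in> L2 M"
  using assms by (auto simp: bounded_ops_def)

lemma op_diff_bounded:
  assumes V: "V \<in> bounded_ops M" and W: "W \<in> bounded_ops M"
  shows "op_diff M V W \<in> bounded_ops M"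
proof -
  obtain C where C: "\<And>F. F \<in> L2 M \<Longrightarrow> L2_norm M (V F) \<le> C * L2_norm M F"
    using V unfolding bounded_ops_def by blast
  obtain D where D: "\<And>F. F \<in> L2 M \<Longrightarrow> L2_norm M (W F) \<le> D * L2_norm M F"
    using W unfolding bounded_ops_def by blast
  have bd: "L2_norm M (L2_diff M (V F) (W F)) \<le> (C + D) * L2_norm M F" if F: "F \<in> L2 M" for F
    using L2_norm_diff_le[OF bounded_opsD[OF V F] bounded_opsD[OF W F]] C[OF F] D[OF F]
    by (simp add: algebra_simps)
  have lin: "\<And>F G. F \<in> L2 M \<Longrightarrow> G \<in> L2 M \<Longrightarrow> V (L2_add M F G) = L2_add M (V F) (V G)"
    "\<And>F G. F \<in> L2 M \<Longrightarrow> G \<in> L2 M \<Longrightarrow> W (L2_add M F G) = L2_add M (W F) (W G)"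
    "\<And>c F. F \<in> L2 M \<Longrightarrow> V (L2_scale M c F) = L2_scale M c (V F)"
    "\<And>c F. F \<in> L2 M \<Longrightarrow> W (L2_scale M c F) = L2_scale M c (W F)"
    using V W by (auto simp: bounded_ops_def)
  show ?thesis
    unfolding bounded_ops_def op_diff_def
    using bd by (auto simp: lin L2_add_in L2_scale_in L2_diff_in L2_diff_add L2_diff_scale
        bounded_opsD[OF V] bounded_opsD[OF W] intro!: exI[of _ "C + D"])
qed

lemma op_norm_bdd_above:
  assumes W: "W \<in> bounded_ops M"
  shows "bdd_above ((\<lambda>F. L2_norm M (W F)) ` {F \<in> L2 M. L2_norm M F \<le> 1})"
proof -
  obtain C where C: "\<And>F. F \<in> L2 M \<Longrightarrow> L2_norm M (W F) \<le> C * L2_norm M F"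
    using W unfolding bounded_ops_def by blast
  have "L2_norm M (W F) \<le> \<bar>C\<bar>" if "F \<in> L2 M" "L2_norm M F \<le> 1" for F
  proof -
    have "C * L2_norm M F \<le> \<bar>C\<bar> * 1"
      using that L2_norm_nonneg[of M F] by (intro mult_mono) auto
    then show ?thesis using C[OF that(1)] by simp
  qed
  then show ?thesis by (intro bdd_aboveI[of _ "\<bar>C\<bar>"]) auto
qed

lemma unit_ball_nonempty: "L2_class M (\<lambda>x. 0) \<in> {F \<in> L2 M. L2_norm M F \<le> 1}"
  by (simp add: L2_norm_zero L2_class_in zero_sq_int)

lemma op_norm_upper:
  assumes "W \<in> bounded_ops M" "F \<in> L2 M" "L2_norm M F \<le> 1"
  shows "L2_norm M (W F) \<le> op_norm M W"
  unfolding op_norm_def using assms by (intro cSUP_upper op_norm_bdd_above) auto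

lemma op_norm_least:
  assumes "\<And>F. F \<in> L2 M \<Longrightarrow> L2_norm M F \<le> 1 \<Longrightarrow> L2_norm M (W F) \<le> c"
  shows "op_norm M W \<le> c"
  unfolding op_norm_def using unit_ball_nonempty[of M] assms by (intro cSUP_least) auto

lemma op_norm_nonneg:
  assumes "W \<in> bounded_ops M"
  shows "0 \<le> op_norm M W"
  using op_norm_upper[OF assms, of "L2_class M (\<lambda>x. 0)"] unit_ball_nonempty[of M]
    L2_norm_nonneg[of M "W (L2_class M (\<lambda>x. 0))"] by auto

lemma op_norm_bound:
  assumes W: "W \<in> bounded_ops M" and F: "F \<in> L2 M"
  shows "L2_norm M (W F) \<le> op_norm M W * L2_norm M F"
proof (cases "L2_norm M F = 0")
  case True
  then show ?thesis using W F by (auto simp: bounded_ops_def)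
next
  case False
  then have pos: "L2_norm M F > 0" using L2_norm_nonneg[of M F] by simp
  define c where "c = complex_of_real (inverse (L2_norm M F))"
  have c: "cmod c = inverse (L2_norm M F)" using pos by (simp add: c_def norm_inverse)
  have "L2_norm M (L2_scale M c F) = 1" using pos by (simp add: L2_norm_scale[OF F] c)
  then have "L2_norm M (W (L2_scale M c F)) \<le> op_norm M W"
    using op_norm_upper[OF W L2_scale_in[OF F]] by simp
  moreover have "W (L2_scale M c F) = L2_scale M c (W F)"
    using W F by (simp add: bounded_ops_def)
  ultimately have "inverse (L2_norm M F) * L2_norm M (W F) \<le> op_norm M W"
    using L2_norm_scale[OF bounded_opsD[OF W F]] c by simp
  then show ?thesis using pos by (simp add: field_simps)
qed

lemma Metric_space_bounded_ops: "Metric_space (bounded_ops M) (op_dist M)"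
proof
  have comm: "op_norm M (op_diff M V W) \<le> op_norm M (op_diff M W V)"
    if V: "V \<in> bounded_ops M" and W: "W \<in> bounded_ops M" for V W
  proof (rule op_norm_least)
    fix F assume F: "F \<in> L2 M" "L2_norm M F \<le> 1"
    then show "L2_norm M (op_diff M V W F) \<le> op_norm M (op_diff M W V)"
      using op_norm_upper[OF op_diff_bounded[OF W V] F]
        L2_diff_commute[OF bounded_opsD[OF V F(1)] bounded_opsD[OF W F(1)]]
      by (simp add: op_diff_def)
  qed
  show "0 \<le> op_dist M V W" for V W
    by (simp add: op_dist_def op_norm_nonneg op_diff_bounded)
  show "op_dist M V W = op_dist M W V" for V W
    using comm[of V W] comm[of W V] by (auto simp: op_dist_def)
  show "op_dist M V W = 0 \<longleftrightarrow> V = W" if V: "V \<in> bounded_ops M" and W: "W \<in> bounded_ops M" for V W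
  proof
    assume 0: "op_dist M V W = 0"
    have "V F = W F" if F: "F \<in> L2 M" for F
    proof -
      have "L2_norm M (op_diff M V W F) \<le> 0"
        using op_norm_bound[OF op_diff_bounded[OF V W] F] 0 V W by (simp add: op_dist_def)
      then have "L2_norm M (L2_diff M (V F) (W F)) = 0"
        using L2_norm_nonneg[of M "L2_diff M (V F) (W F)"] F by (simp add: op_diff_def)
      then show ?thesis
        using L2_norm_diff_0 bounded_opsD[OF V F] bounded_opsD[OF W F] by blast
    qed
    moreover have "V \<in> extensional (L2 M)" "W \<in> extensional (L2 M)"
      using V W by (auto simp: bounded_ops_def PiE_def)
    ultimately show "V = W" by (rule extensionalityI[rotated 2])
  next
    assume "V = W"
    have "op_norm M (op_diff M V V) \<le> 0"
    proof (rule op_norm_least)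
      fix F assume F: "F \<in> L2 M" "L2_norm M F \<le> 1"
      obtain f where f: "f \<in> sq_int M" "V F = L2_class M f"
        by (rule L2_E[OF bounded_opsD[OF V F(1)]])
      show "L2_norm M (op_diff M V V F) \<le> 0"
        using F f by (simp add: op_diff_def L2_diff_class L2_norm_zero)
    qed
    then show "op_dist M V W = 0"
      using op_norm_nonneg[OF op_diff_bounded[OF V V]] \<open>V = W\<close> by (simp add: op_dist_def)
  qed
  show "op_dist M U W \<le> op_dist M U V + op_dist M V W"
    if U: "U \<in> bounded_ops M" and V: "V \<in> bounded_ops M" and W: "W \<in> bounded_ops M" for U V W
  proof -
    have "op_norm M (op_diff M U W) \<le> op_norm M (op_diff M U V) + op_norm M (op_diff M V W)"
    proof (rule op_norm_least)
      fix F assume F: "F \<in> L2 M" "L2_norm M F \<le> 1"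
      show "L2_norm M (op_diff M U W F) \<le> op_norm M (op_diff M U V) + op_norm M (op_diff M V W)"
        using op_norm_upper[OF op_diff_bounded[OF U V] F] op_norm_upper[OF op_diff_bounded[OF V W] F]
          L2_norm_diff_triangle[OF bounded_opsD[OF U F(1)] bounded_opsD[OF V F(1)]
            bounded_opsD[OF W F(1)]] F
        by (simp add: op_diff_def)
    qed
    then show ?thesis using U V W by (simp add: op_dist_def)
  qed
qed

end

theory Submission
  imports Defs
begin

text \<open>
  Since projections are contractions, \<open>\<parallel>V \<pi>\<^sub>Y\<parallel> \<le> \<parallel>W \<pi>\<^sub>Y\<parallel> + \<parallel>V - W\<parallel>\<close> for every \<open>Y\<close>. The
  measures of the cells of a partition \<open>\<chi>\<close> sum to \<open>1\<close>, so Minkowski's inequality in the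
  weighted \<open>\<ell>\<^sup>2\<close>-norm gives \<open>\<surd>\<M>\<^sub>\<chi>(V) \<le> \<surd>\<M>\<^sub>\<chi>(W) + \<parallel>V - W\<parallel>\<close>; take the infimum over \<open>\<chi>\<close>.
\<close>

lemma sq_int_indicator:
  assumes Y: "Y \<in> sets M" and f: "f \<in> sq_int M"
  shows "(\<lambda>x. indicator Y x * f x) \<in> sq_int M"
proof -
  have [measurable]: "f \<in> borel_measurable M" "Y \<in> sets M" using f Y by (auto simp: sq_int_def)
  have "integrable M (\<lambda>x. (cmod (indicator Y x * f x))\<^sup>2)"
  proof (rule Bochner_Integration.integrable_bound)
    show "integrable M (\<lambda>x. (cmod (f x))\<^sup>2)" using f by (simp add: sq_int_def)
  qed (auto simp: indicator_def intro!: AE_I2)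
  then show ?thesis by (simp add: sq_int_def)
qed

lemma op_proj_in: "Y \<in> sets M \<Longrightarrow> F \<in> L2 M \<Longrightarrow> op_proj M Y F \<in> L2 M"
  by (simp add: op_proj_def L2_class_in sq_int_indicator L2_rep_sq_int)

lemma L2_norm_op_proj_le:
  assumes Y: "Y \<in> sets M" and F: "F \<in> L2 M"
  shows "L2_norm M (op_proj M Y F) \<le> L2_norm M F"
proof -
  have f: "L2_rep F \<in> sq_int M" by (rule L2_rep_sq_int[OF F])
  note g = sq_int_indicator[OF Y f]
  have "(\<integral>x. (cmod (indicator Y x * L2_rep F x))\<^sup>2 \<partial>M) \<le> (\<integral>x. (cmod (L2_rep F x))\<^sup>2 \<partial>M)"
    using f g by (intro integral_mono) (auto simp: sq_int_def indicator_def)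
  \<comment> \<open>The norm of the projected class is computed from the explicit product with the
    indicator, and the norm of \<open>F\<close> is by definition that of \<open>L2_rep F\<close>, so
    the integrals above are the squares of the two norms.\<close>
  then show ?thesis
    using F g by (simp add: op_proj_def L2_norm_class) (simp add: L2_norm_def)
qed

lemma L2_norm_le_add_diff:
  assumes F: "F \<in> L2 M" and G: "G \<in> L2 M"
  shows "L2_norm M F \<le> L2_norm M G + L2_norm M (L2_diff M F G)"
proof -
  obtain f where f: "f \<in> sq_int M" "F = L2_class M f" by (rule L2_E[OF F])
  obtain g where g: "g \<in> sq_int M" "G = L2_class M g" by (rule L2_E[OF G])
  have "F = L2_add M G (L2_diff M F G)"
    by (simp add: f g L2_diff_class L2_add_class sq_int_diff)
  then show ?thesis using L2_norm_add[OF G L2_diff_in[OF F G]] by simp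
qed

text \<open>A real supremum dominates its members only if they are bounded above. Here
  \<open>op_norm M W\<close> is such a bound, because \<open>op_proj\<close> sends the unit ball
  into itself.\<close>

lemma L2_norm_op_proj_upper:
  assumes W: "W \<in> bounded_ops M" and Y: "Y \<in> sets M" and F: "F \<in> L2 M" "L2_norm M F \<le> 1"
  shows "L2_norm M (W (op_proj M Y F)) \<le> op_norm M (compose (L2 M) W (op_proj M Y))"
proof -
  have "L2_norm M (W (op_proj M Y G)) \<le> op_norm M W" if "G \<in> L2 M" "L2_norm M G \<le> 1" for G
    using op_norm_upper[OF W op_proj_in[OF Y that(1)]] L2_norm_op_proj_le[OF Y that(1)] that(2)
    by simp
  then have "bdd_above ((\<lambda>G. L2_norm M (compose (L2 M) W (op_proj M Y) G)) `
      {G \<in> L2 M. L2_norm M G \<le> 1})"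
    by (intro bdd_aboveI[of _ "op_norm M W"]) (auto simp: compose_def)
  then have "L2_norm M (compose (L2 M) W (op_proj M Y) F)
      \<le> op_norm M (compose (L2 M) W (op_proj M Y))"
    unfolding op_norm_def using F by (intro cSUP_upper) auto
  then show ?thesis using F by (simp add: compose_def)
qed

lemma op_norm_compose_proj_nonneg:
  assumes "W \<in> bounded_ops M" "Y \<in> sets M"
  shows "0 \<le> op_norm M (compose (L2 M) W (op_proj M Y))"
  using L2_norm_op_proj_upper[OF assms] unit_ball_nonempty[of M] L2_norm_nonneg order_trans
  by blast

text \<open>At the projected vector \<open>?G\<close>, split V into W plus the difference V - W. As
  \<open>?G\<close> stays in the unit ball, the full operator norm of the difference controls the
  second term.\<close>

lemma op_norm_compose_proj_le:
  assumes V: "V \<in> bounded_ops M" and W: "W \<in> bounded_ops M" and Y: "Y \<in> sets M"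
  shows "op_norm M (compose (L2 M) V (op_proj M Y))
    \<le> op_norm M (compose (L2 M) W (op_proj M Y)) + op_norm M (op_diff M V W)"
proof (rule op_norm_least)
  fix F assume F: "F \<in> L2 M" "L2_norm M F \<le> 1"
  let ?G = "op_proj M Y F"
  have G: "?G \<in> L2 M" by (rule op_proj_in[OF Y F(1)])
  have "L2_norm M ?G \<le> 1" using L2_norm_op_proj_le[OF Y F(1)] F(2) by simp
  then have "L2_norm M (L2_diff M (V ?G) (W ?G)) \<le> op_norm M (op_diff M V W)"
    using op_norm_upper[OF op_diff_bounded[OF V W] G] G by (simp add: op_diff_def)
  then show "L2_norm M (compose (L2 M) V (op_proj M Y) F)
      \<le> op_norm M (compose (L2 M) W (op_proj M Y)) + op_norm M (op_diff M V W)"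
    using L2_norm_le_add_diff[OF bounded_opsD[OF V G] bounded_opsD[OF W G]]
      L2_norm_op_proj_upper[OF W Y F] F by (simp add: compose_def)
qed

text \<open>Cells overlap only in null sets, so their measures add up to the measure of their union,
  which is a probability.\<close>

lemma sum_measure_partition_le_1:
  assumes "prob_space M" and Y: "is_partition M J Y"
  shows "(\<Sum>j=1..J. measure M (Y j)) \<le> 1"
proof -
  interpret prob_space M by fact
  have "AE x in M. x \<notin> Y j \<or> x \<notin> Y k" if "j \<in> {1..J}" "k \<in> {1..J}" "j \<noteq> k" for j k
  proof -
    have "Y j \<inter> Y k \<in> null_sets M"
      using Y that by (auto simp: is_partition_def null_sets_def emeasure_eq_measure)
    from AE_not_in[OF this] show ?thesis by auto
  qed
  then have "measure M (\<Union>j\<in>{1..J}. Y j) = (\<Sum>j=1..J. measure M (Y j))"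
    using Y by (intro measure_UNION_AE)
      (auto simp: is_partition_def fmeasurable_eq_sets pairwise_def)
  then show ?thesis using prob_le_1[of "\<Union>j\<in>{1..J}. Y j"] by simp
qed

lemma sqrt_partition_sum_le:
  assumes M: "prob_space M" and Y: "is_partition M J Y"
    and V: "V \<in> bounded_ops M" and W: "W \<in> bounded_ops M"
  shows "sqrt (partition_sum M J Y V) \<le> sqrt (partition_sum M J Y W) + op_norm M (op_diff M V W)"
proof -
  define n where "n U j = op_norm M (compose (L2 M) U (op_proj M (Y j)))" for U j
  \<comment> \<open>Square roots of the weights make \<open>sqrt (partition_sum M J Y U)\<close> the
    Euclidean norm of the vector with entries \<open>s j * n U j\<close>.\<close>
  define s where "s j = sqrt (measure M (Y j))" for j
  define d where "d = op_norm M (op_diff M V W)"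
  have Yj: "Y j \<in> sets M" if "j \<in> {1..J}" for j
    using Y that by (simp add: is_partition_def)
  have d: "0 \<le> d" unfolding d_def by (rule op_norm_nonneg[OF op_diff_bounded[OF V W]])
  have s: "0 \<le> s j" for j by (simp add: s_def)
  have eq: "sqrt (partition_sum M J Y U) = L2_set (\<lambda>j. s j * n U j) {1..J}" for U
    by (simp add: partition_sum_def L2_set_def power_mult_distrib s_def n_def)
  have "L2_set (\<lambda>j. s j * n V j) {1..J} \<le> L2_set (\<lambda>j. s j * n W j + s j * d) {1..J}"
  proof (rule L2_set_mono)
    fix j assume j: "j \<in> {1..J}"
    have "n V j \<le> n W j + d"
      unfolding n_def d_def by (rule op_norm_compose_proj_le[OF V W Yj[OF j]])
    from mult_left_mono[OF this s[of j]]
    show "s j * n V j \<le> s j * n W j + s j * d" by (simp add: distrib_left)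
    show "0 \<le> s j * n V j"
      using s[of j] op_norm_compose_proj_nonneg[OF V Yj[OF j]] by (simp add: n_def)
  qed
  also have "\<dots> \<le> L2_set (\<lambda>j. s j * n W j) {1..J} + L2_set (\<lambda>j. s j * d) {1..J}"
    by (rule L2_set_triangle_ineq)
  also have "L2_set (\<lambda>j. s j * d) {1..J} = L2_set s {1..J} * d"
    by (rule L2_set_left_distrib[OF d, symmetric])
  \<comment> \<open>The squares of the \<open>s j\<close> are the cell measures, so the error is at
    most \<open>d\<close>, however many cells there are.\<close>
  also have "L2_set s {1..J} \<le> 1"
    using sum_measure_partition_le_1[OF M Y] by (simp add: L2_set_def s_def)
  then have "L2_set s {1..J} * d \<le> d"
    using d mult_right_mono by fastforce
  finally show ?thesis by (simp add: eq d_def)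
qed

text \<open>This one-cell partition shows that the infimum in \<open>mu_norm\<close> is over a
  nonempty set.\<close>

lemma is_partition_space: "is_partition M 1 (\<lambda>_. space M)"
  by (simp add: is_partition_def)

lemma mu_norm_le_add:
  assumes M: "prob_space M" and V: "V \<in> bounded_ops M" and W: "W \<in> bounded_ops M"
  shows "mu_norm M V \<le> mu_norm M W + op_norm M (op_diff M V W)"
proof -
  let ?A = "\<lambda>U. {sqrt (partition_sum M J Y U) | J Y. is_partition M J Y}"
  have "bdd_below (?A V)"
    by (rule bdd_belowI[of _ 0]) (auto simp: partition_sum_def intro!: sum_nonneg)
  then have "mu_norm M V \<le> sqrt (partition_sum M J Y V)" if "is_partition M J Y" for J Y
    unfolding mu_norm_def using that by (intro cInf_lower) auto
  \<comment> \<open>With the error moved to the left, that side is independent of the partition and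
    so is a lower bound for the set whose infimum is \<open>mu_norm M W\<close>.\<close>
  then have "mu_norm M V - op_norm M (op_diff M V W) \<le> sqrt (partition_sum M J Y W)"
    if "is_partition M J Y" for J Y
    using sqrt_partition_sum_le[OF M that V W] that by fastforce
  moreover have "?A W \<noteq> {}" using is_partition_space[of M] by blast
  ultimately have "mu_norm M V - op_norm M (op_diff M V W) \<le> mu_norm M W"
    unfolding mu_norm_def by (intro cInf_greatest) auto
  then show ?thesis by simp
qed

theorem corollary2p2:
  fixes M :: "'a measure"
  assumes "prob_space M"
  shows "(\<forall>W1\<in>bounded_ops M. \<forall>W2\<in>bounded_ops M.
            \<bar>mu_norm M W2 - mu_norm M W1\<bar> \<le> op_norm M (op_diff M W2 W1)) \<and>
         continuous_map (Metric_space.mtopology (bounded_ops M) (op_dist M)) euclideanreal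
            (mu_norm M)"
proof -
  interpret B: Metric_space "bounded_ops M" "op_dist M" by (rule Metric_space_bounded_ops)
  \<comment> \<open>The one-sided estimate is used in both orders; symmetry of
    \<open>op_dist\<close> makes the two error terms equal.\<close>
  have dist: "\<bar>mu_norm M V - mu_norm M W\<bar> \<le> op_dist M V W"
    if V: "V \<in> bounded_ops M" and W: "W \<in> bounded_ops M" for V W
    using mu_norm_le_add[OF assms V W] mu_norm_le_add[OF assms W V] B.commute[of V W] V W
    by (simp add: op_dist_def)
  \<comment> \<open>A 1-Lipschitz function is continuous: take \<delta> = \<epsilon>.\<close>
  have "continuous_map B.mtopology (Metric_space.mtopology UNIV dist) (mu_norm M)"
    unfolding B.metric_continuous_map[OF Met_TC.Metric_space_axioms] dist_real_def
    using dist by (meson order_le_less_trans subset_UNIV)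
  then show ?thesis
    using dist by (auto simp: op_dist_def)
qed

end
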